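(* Let $k,n\in\mathbb{N}$ be positive integers with $k\le n$ and let $A\in\mathsf{S}^2_{++}(\mathbb{R}^k)$. Then $$\operatorname{V}_A(k,n)=\Bigl\{Q\begin{bmatrix}R\\0\end{bmatrix}:Q\in\operatorname{O}_n(\mathbb{R})\Bigr\},$$ where $R\in\operatorname{GL}_k(\mathbb{R})$ is the unique Cholesky factor of $A$.
   Context: $\mathsf{S}^2_{++}(\mathbb{R}^k)$ is the set of $k\times k$ real symmetric positive definite matrices, and $\operatorname{V}_A(k,n):=\{Y\in\mathbb{R}^{n\times k}:Y^{\mathsf T}Y=A\}$. The Cholesky factor of $A$ is the unique upper triangular $R\in\operatorname{GL}_k(\mathbb{R})$ with positive diagonal entries such that $A=R^{\mathsf T}R$. The $0$ denotes the $(n-k)\times k$ zero block. *)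

theory Defs
  imports Complex_Main "Jordan_Normal_Form.Matrix"
begin

definition spd_mats :: "nat \<Rightarrow> real mat set" where
  "spd_mats k = {A \<in> carrier_mat k k. A\<^sup>T = A \<and>
     (\<forall>x \<in> carrier_vec k. x \<noteq> 0\<^sub>v k \<longrightarrow> 0 < x \<bullet> (A *\<^sub>v x))}"

definition GL :: "nat \<Rightarrow> real mat set" where
  "GL k = {R \<in> carrier_mat k k. invertible_mat R}"

(* The library's orthogonal_mat only requires pairwise orthogonal nonzero columns,
   so it is not the orthogonal group. *)
definition O_mats :: "nat \<Rightarrow> real mat set" where
  "O_mats n = {Q \<in> carrier_mat n n. Q\<^sup>T * Q = 1\<^sub>m n}"

definition V_mats :: "real mat \<Rightarrow> nat \<Rightarrow> nat \<Rightarrow> real mat set" where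
  "V_mats A k n = {Y \<in> carrier_mat n k. Y\<^sup>T * Y = A}"

definition is_cholesky_factor :: "real mat \<Rightarrow> real mat \<Rightarrow> bool" where
  "is_cholesky_factor A R \<longleftrightarrow>
     R \<in> GL (dim_row A) \<and> upper_triangular R \<and> (\<forall>i < dim_row A. 0 < R $$ (i, i)) \<and> A = R\<^sup>T * R"

definition cholesky_factor :: "real mat \<Rightarrow> real mat" where
  "cholesky_factor A = (THE R. is_cholesky_factor A R)"

end

theory Submission
  imports Defs "Jordan_Normal_Form.Determinant"
begin

text \<open>
  The set \<open>V\<^sub>A\<close> is a fibre of the Gram map \<open>Y \<mapsto> Y\<^sup>T Y\<close>, and the fibres of this map on
  \<open>n \<times> k\<close> matrices are exactly the orbits of the orthogonal group acting from the left
  (\<open>gram_eq_iff_orthogonally_equivalent\<close>). So \<open>V\<^sub>A\<close> is the orbit of any one of its points, and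
  for \<open>k \<le> n\<close> the Cholesky factor of \<open>A\<close> padded with zero rows is such a point.

  That the columns of \<open>Z\<close> can be moved onto those of \<open>Y\<close> whenever the two Gram matrices agree is
  shown one column at a time with Householder reflections. Once the first \<open>j\<close> columns agree, the
  reflection that swaps the two \<open>j\<close>-th columns (counted from 0) has its axis orthogonal to the
  earlier columns, because the inner products with them agree; hence it leaves these columns in
  place. This route avoids extending an orthonormal family to a basis, and it applies to matrices
  of any rank.

  The Cholesky factor itself exists by induction on the size: the first row of \<open>R\<close> is forced, and
  what remains to be factored is the Schur complement of the first entry, which is again positive
  definite. It is unique because the entries of \<open>R\<^sup>T R\<close> determine the rows of \<open>R\<close> from the top
  downwards.
\<close>

section \<open>Householder reflections\<close>

text \<open>
  The reflection \<open>I - (2 / (w \<bullet> w)) w w\<^sup>T\<close> in the hyperplane orthogonal to \<open>w\<close>. Since division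
  by zero yields zero, \<open>w = 0\<close> gives the identity, so the facts below hold for every \<open>w\<close>.
\<close>

definition householder :: "real vec \<Rightarrow> real mat" where
  "householder w = mat (dim_vec w) (dim_vec w)
     (\<lambda>(i, j). (if i = j then 1 else 0) - 2 / (w \<bullet> w) * (w $ i * w $ j))"

lemma householder_orthogonal:
  assumes "w \<in> carrier_vec n"
  shows "householder w \<in> O_mats n"
proof -
  define c where "c = 2 / (w \<bullet> w)"
  define s where "s = (\<Sum>l = 0..<n. w $ l * w $ l)"
  have s: "w \<bullet> w = s"
    using assms by (simp add: scalar_prod_def s_def)
  \<comment> \<open>For \<open>w = 0\<close> both sides vanish because \<open>c = 0\<close>.\<close>
  have cs: "c * c * s = 2 * c"
    unfolding c_def s by (cases "s = 0") auto
  have dim: "dim_vec w = n" using assms by simp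
  have "(householder w)\<^sup>T * householder w = 1\<^sub>m n"
  proof (rule eq_matI)
    fix i j assume "i < dim_row (1\<^sub>m n :: real mat)" "j < dim_col (1\<^sub>m n :: real mat)"
    then have ij: "i < n" "j < n" by auto
    have "((householder w)\<^sup>T * householder w) $$ (i, j) =
      (\<Sum>l = 0..<n. ((if l = i then 1 else 0) - c * (w $ l * w $ i)) *
                    ((if l = j then 1 else 0) - c * (w $ l * w $ j)))"
      using ij dim by (simp add: householder_def scalar_prod_def c_def)
    also have "\<dots> = (\<Sum>l = 0..<n. (if l = i then (if l = j then 1 else 0) - c * (w $ l * w $ j) else 0)
        - (if l = j then c * (w $ l * w $ i) else 0)
        + c * c * (w $ i * w $ j) * (w $ l * w $ l))"
      by (intro sum.cong) (auto simp: algebra_simps)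
    also have "\<dots> = ((if i = j then 1 else 0) - c * (w $ i * w $ j)) - c * (w $ j * w $ i)
        + c * c * (w $ i * w $ j) * s"
      using ij by (simp add: sum.distrib sum_subtractf s_def flip: sum_distrib_left)
    also have "\<dots> = (if i = j then 1 else 0) + (c * c * s - 2 * c) * (w $ i * w $ j)"
      by (simp add: algebra_simps)
    finally show "((householder w)\<^sup>T * householder w) $$ (i, j) = 1\<^sub>m n $$ (i, j)"
      using ij cs by simp
  qed (use dim in \<open>auto simp: householder_def\<close>)
  then show ?thesis
    using dim by (auto simp: O_mats_def householder_def)
qed

lemma householder_mult_vec:
  assumes "w \<in> carrier_vec n" "x \<in> carrier_vec n"
  shows "householder w *\<^sub>v x = x - (2 / (w \<bullet> w) * (w \<bullet> x)) \<cdot>\<^sub>v w"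
proof (rule eq_vecI)
  fix i assume "i < dim_vec (x - (2 / (w \<bullet> w) * (w \<bullet> x)) \<cdot>\<^sub>v w)"
  then have i: "i < n" using assms by simp
  define c where "c = 2 / (w \<bullet> w)"
  have "(householder w *\<^sub>v x) $ i
      = (\<Sum>l = 0..<n. ((if i = l then 1 else 0) - c * (w $ i * w $ l)) * x $ l)"
    using i assms by (simp add: householder_def scalar_prod_def c_def)
  also have "\<dots> = (\<Sum>l = 0..<n. (if i = l then x $ l else 0) - c * w $ i * (w $ l * x $ l))"
    by (intro sum.cong) (auto simp: algebra_simps)
  also have "\<dots> = x $ i - c * w $ i * (w \<bullet> x)"
    using i assms by (simp add: sum_subtractf scalar_prod_def flip: sum_distrib_left)
  finally show "(householder w *\<^sub>v x) $ i = (x - (2 / (w \<bullet> w) * (w \<bullet> x)) \<cdot>\<^sub>v w) $ i"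
    using i assms by (simp add: c_def)
qed (use assms in \<open>auto simp: householder_def\<close>)

lemma householder_fixes_orthogonal:
  assumes "w \<in> carrier_vec n" "x \<in> carrier_vec n" "w \<bullet> x = 0"
  shows "householder w *\<^sub>v x = x"
  using assms by (auto simp: householder_mult_vec)

text \<open>
  The difference of two vectors of equal length is orthogonal to their sum, so the reflection
  along \<open>u - v\<close> fixes the midpoint of \<open>u\<close> and \<open>v\<close> and exchanges the two.
\<close>
lemma householder_swaps:
  assumes u: "u \<in> carrier_vec n" and v: "v \<in> carrier_vec n" and eq: "u \<bullet> u = v \<bullet> v"
  shows "householder (u - v) *\<^sub>v u = v"
proof (cases "u - v = 0\<^sub>v n")
  case True
  have "u = v"
  proof (rule eq_vecI)
    fix i assume "i < dim_vec v"
    then show "u $ i = v $ i"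
      using arg_cong[OF True, of "\<lambda>x. x $ i"] u v by simp
  qed (use u v in auto)
  then show ?thesis
    using True householder_fixes_orthogonal[of "0\<^sub>v n" n v] v by simp
next
  case False
  define w where "w = u - v"
  have w: "w \<in> carrier_vec n" using u v by (simp add: w_def)
  have wu: "w \<bullet> u = u \<bullet> u - v \<bullet> u"
    unfolding w_def using u v by (simp add: minus_scalar_prod_distrib)
  have wv: "w \<bullet> v = u \<bullet> v - v \<bullet> v"
    unfolding w_def using u v by (simp add: minus_scalar_prod_distrib)
  have "w \<bullet> w = w \<bullet> u - w \<bullet> v"
    using u v w by (simp add: scalar_prod_minus_distrib[of _ n] w_def)
  also have "\<dots> = 2 * (w \<bullet> u)"
    using wu wv eq comm_scalar_prod[OF u v] by simp
  finally have ww: "w \<bullet> w = 2 * (w \<bullet> u)" .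
  \<comment> \<open>The coefficient of \<open>w\<close> in the reflected vector is therefore 1.\<close>
  have "w \<bullet> w \<noteq> 0"
    using False conjugate_square_eq_0_vec[OF w] by (simp add: w_def)
  then have "2 / (w \<bullet> w) * (w \<bullet> u) = 1"
    using ww by simp
  then have "householder w *\<^sub>v u = u - 1 \<cdot>\<^sub>v w"
    using householder_mult_vec[OF w u] by simp
  also have "\<dots> = v" using u v by (auto simp: w_def)
  finally show ?thesis by (simp add: w_def)
qed

section \<open>Gram matrices and orthogonal equivalence\<close>

lemma orthogonal_scalar_prod:
  assumes "Q \<in> O_mats n" "x \<in> carrier_vec n" "y \<in> carrier_vec n"
  shows "(Q *\<^sub>v x) \<bullet> (Q *\<^sub>v y) = x \<bullet> y"
proof -
  have Q: "Q \<in> carrier_mat n n" "Q\<^sup>T * Q = 1\<^sub>m n" using assms by (auto simp: O_mats_def)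
  have "(Q *\<^sub>v x) \<bullet> (Q *\<^sub>v y) = (Q\<^sup>T *\<^sub>v (Q *\<^sub>v x)) \<bullet> y"
    using transpose_vec_mult_scalar[OF Q(1) assms(3), of "Q *\<^sub>v x"] Q(1) assms(2) by simp
  also have "Q\<^sup>T *\<^sub>v (Q *\<^sub>v x) = (Q\<^sup>T * Q) *\<^sub>v x"
    using Q(1) assms(2) by (subst assoc_mult_mat_vec) auto
  finally show ?thesis using Q(2) assms by simp
qed

lemma orthogonal_mult:
  assumes "P \<in> O_mats n" "Q \<in> O_mats n"
  shows "P * Q \<in> O_mats n"
proof -
  have P: "P \<in> carrier_mat n n" "P\<^sup>T * P = 1\<^sub>m n" and Q: "Q \<in> carrier_mat n n" "Q\<^sup>T * Q = 1\<^sub>m n"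
    using assms by (auto simp: O_mats_def)
  have "(P * Q)\<^sup>T * (P * Q) = Q\<^sup>T * (P\<^sup>T * P) * Q"
    using P(1) Q(1) by (simp add: transpose_mult assoc_mult_mat[of _ n n _ n _ n])
  then show ?thesis using P Q by (simp add: O_mats_def)
qed

text \<open>
  For the forward direction, an orthogonal matrix that maps the first \<open>j\<close> columns of \<open>Z\<close> to those
  of \<open>Y\<close> is followed by the reflection that swaps the image of the next column of \<open>Z\<close> with the
  next column of \<open>Y\<close>. Equality
  of the diagonal Gram entries makes the swap possible; equality of the other ones makes the
  reflection fix the columns already treated.
\<close>
lemma gram_eq_iff_orthogonally_equivalent:
  assumes Y: "Y \<in> carrier_mat n k" and Z: "Z \<in> carrier_mat n k"
  shows "Y\<^sup>T * Y = Z\<^sup>T * Z \<longleftrightarrow> (\<exists>Q \<in> O_mats n. Y = Q * Z)"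
proof
  assume gram: "Y\<^sup>T * Y = Z\<^sup>T * Z"
  have ip: "col Y i \<bullet> col Y j = col Z i \<bullet> col Z j" if "i < k" "j < k" for i j
    using arg_cong[OF gram, of "\<lambda>M. M $$ (i, j)"] that Y Z by simp
  have cols: "col Y i \<in> carrier_vec n" "col Z i \<in> carrier_vec n" for i
    using Y Z by auto
  have "\<exists>Q \<in> O_mats n. \<forall>i<j. Q *\<^sub>v col Z i = col Y i" if "j \<le> k" for j
    using that
  proof (induction j)
    case 0
    have "1\<^sub>m n \<in> O_mats n" by (simp add: O_mats_def)
    then show ?case by auto
  next
    case (Suc j)
    then obtain Q where Q: "Q \<in> O_mats n" and agree: "\<And>i. i < j \<Longrightarrow> Q *\<^sub>v col Z i = col Y i"
      by auto
    have Qc: "Q \<in> carrier_mat n n" using Q by (simp add: O_mats_def)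
    define u v where "u = Q *\<^sub>v col Z j" and "v = col Y j"
    define H where "H = householder (u - v)"
    have uv: "u \<in> carrier_vec n" "v \<in> carrier_vec n"
      using Qc cols by (auto simp: u_def v_def)
    have H: "H \<in> O_mats n"
      unfolding H_def using uv by (intro householder_orthogonal) auto
    have Hc: "H \<in> carrier_mat n n" using H by (simp add: O_mats_def)
    have "(H * Q) *\<^sub>v col Z i = col Y i" if "i < Suc j" for i
    proof -
      have assoc: "(H * Q) *\<^sub>v col Z i = H *\<^sub>v (Q *\<^sub>v col Z i)"
        using Hc Qc cols by (intro assoc_mult_mat_vec) auto
      show ?thesis
      proof (cases "i = j")
        case True
        have "u \<bullet> u = v \<bullet> v"
          unfolding u_def v_def using orthogonal_scalar_prod[OF Q cols(2) cols(2)] ip Suc.prems by simp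
        then show ?thesis
          using assoc True householder_swaps[OF uv] by (simp add: H_def u_def v_def)
      next
        case False
        with that have ij: "i < j" by simp
        have "u \<bullet> col Y i = v \<bullet> col Y i"
          using orthogonal_scalar_prod[OF Q cols(2) cols(2), of j i] ip[of j i] agree[OF ij] ij Suc.prems
          by (simp add: u_def v_def)
        then have "(u - v) \<bullet> col Y i = 0"
          using uv cols by (simp add: minus_scalar_prod_distrib[of _ n])
        then have "H *\<^sub>v col Y i = col Y i"
          unfolding H_def using uv cols by (intro householder_fixes_orthogonal) auto
        then show ?thesis using assoc agree[OF ij] by simp
      qed
    qed
    then show ?case using orthogonal_mult[OF H Q] by auto
  qed
  then obtain Q where Q: "Q \<in> O_mats n" and agree: "\<And>i. i < k \<Longrightarrow> Q *\<^sub>v col Z i = col Y i"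
    by auto
  have Qc: "Q \<in> carrier_mat n n" using Q by (simp add: O_mats_def)
  then have "col (Q * Z) i = Q *\<^sub>v col Z i" if "i < k" for i
    using Z that by (rule col_mult2)
  then have "Y = Q * Z"
    using Y Z agree Qc by (intro mat_col_eqI) (simp_all del: col_mult2)
  then show "\<exists>Q \<in> O_mats n. Y = Q * Z" using Q by auto
next
  assume "\<exists>Q \<in> O_mats n. Y = Q * Z"
  then obtain Q where Q: "Q \<in> carrier_mat n n" "Q\<^sup>T * Q = 1\<^sub>m n" and "Y = Q * Z"
    by (auto simp: O_mats_def)
  then have "Y\<^sup>T * Y = Z\<^sup>T * (Q\<^sup>T * (Q * Z))"
    using Z by (simp add: transpose_mult[of _ n n _ k] assoc_mult_mat[of _ k n _ n _ k])
  also have "Q\<^sup>T * (Q * Z) = (Q\<^sup>T * Q) * Z"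
    using Q(1) Z by (intro assoc_mult_mat[symmetric]) auto
  finally show "Y\<^sup>T * Y = Z\<^sup>T * Z" using Q Z by simp
qed

lemma gram_append_zero_rows:
  assumes R: "R \<in> carrier_mat k k"
  shows "(R @\<^sub>r 0\<^sub>m m k)\<^sup>T * (R @\<^sub>r 0\<^sub>m m k) = R\<^sup>T * (R :: real mat)"
proof (rule eq_matI)
  let ?Z = "R @\<^sub>r 0\<^sub>m m k :: real mat"
  have Z: "?Z \<in> carrier_mat (k + m) k" using R by simp
  fix i j assume "i < dim_row (R\<^sup>T * R)" "j < dim_col (R\<^sup>T * R)"
  then have ij: "i < k" "j < k" using R by auto
  have "(?Z\<^sup>T * ?Z) $$ (i, j) = (\<Sum>l = 0..<k + m. ?Z $$ (l, i) * ?Z $$ (l, j))"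
    using ij Z by (simp add: scalar_prod_def)
  also have "\<dots> = (\<Sum>l = 0..<k. ?Z $$ (l, i) * ?Z $$ (l, j))"
    using ij R by (intro sum.mono_neutral_right) (auto simp: append_rows_def)
  also have "\<dots> = (\<Sum>l = 0..<k. R $$ (l, i) * R $$ (l, j))"
    using ij R by (intro sum.cong) (auto simp: append_rows_def)
  also have "\<dots> = (R\<^sup>T * R) $$ (i, j)"
    using ij R by (simp add: scalar_prod_def)
  finally show "(?Z\<^sup>T * ?Z) $$ (i, j) = (R\<^sup>T * R) $$ (i, j)" .
qed (use R in \<open>auto simp: append_rows_def\<close>)

section \<open>Cholesky factorization\<close>

text \<open>
  Symmetric positive definite matrices are represented here by functions on indices, so that
  removing the first row and column is a shift by \<open>Suc\<close>.
\<close>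
lemma cholesky_exists_fun:
  fixes a :: "nat \<Rightarrow> nat \<Rightarrow> real"
  assumes "\<And>i j. i < k \<Longrightarrow> j < k \<Longrightarrow> a i j = a j i"
    and "\<And>x. \<exists>i<k. x i \<noteq> 0 \<Longrightarrow> 0 < (\<Sum>i<k. \<Sum>j<k. x i * a i j * x j)"
  shows "\<exists>r. (\<forall>i j. j < i \<longrightarrow> r i j = 0) \<and> (\<forall>i<k. 0 < r i i) \<and>
    (\<forall>i<k. \<forall>j<k. a i j = (\<Sum>l<k. r l i * r l j))"
  using assms
proof (induction k arbitrary: a)
  case 0
  show ?case by (intro exI[of _ "\<lambda>_ _. 0"]) auto
next
  case (Suc k)
  note sym = Suc.prems(1) and pos = Suc.prems(2)
  have a0: "0 < a 0 0"
    using pos[of "\<lambda>i. if i = 0 then 1 else 0"] by (simp add: sum.lessThan_Suc_shift del: sum.lessThan_Suc)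
  \<comment> \<open>The Schur complement of the entry \<open>a 0 0\<close>.\<close>
  define b where "b i j = a (Suc i) (Suc j) - a 0 (Suc i) * a 0 (Suc j) / a 0 0" for i j
  have "0 < (\<Sum>i<k. \<Sum>j<k. x i * b i j * x j)" if x: "\<exists>i<k. x i \<noteq> 0" for x
  proof -
    define c where "c = (\<Sum>j<k. a 0 (Suc j) * x j)"
    \<comment> \<open>The form of \<open>b\<close> at \<open>x\<close> is the minimum over the leading coordinate of the form of \<open>a\<close>;
      \<open>y\<close> extends \<open>x\<close> by the minimizing value.\<close>
    define y where "y i = (case i of 0 \<Rightarrow> - c / a 0 0 | Suc i \<Rightarrow> x i)" for i
    have y: "y 0 = - c / a 0 0" "\<And>i. y (Suc i) = x i" by (auto simp: y_def)
    have "0 < (\<Sum>i<Suc k. \<Sum>j<Suc k. y i * a i j * y j)"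
      using x by (intro pos) (auto simp: y)
    also have "\<dots> = y 0 * a 0 0 * y 0 + y 0 * c + y 0 * c + (\<Sum>i<k. \<Sum>j<k. x i * a (Suc i) (Suc j) * x j)"
    proof -
      have "(\<Sum>i<k. x i * a (Suc i) 0 * y 0) = y 0 * c"
        unfolding c_def sum_distrib_left using sym by (intro sum.cong) (auto simp: algebra_simps)
      moreover have "(\<Sum>j<k. y 0 * a 0 (Suc j) * x j) = y 0 * c"
        unfolding c_def sum_distrib_left by (simp add: mult.assoc)
      ultimately show ?thesis
        by (simp add: sum.lessThan_Suc_shift y(2) sum.distrib del: sum.lessThan_Suc)
    qed
    also have "\<dots> = (\<Sum>i<k. \<Sum>j<k. x i * a (Suc i) (Suc j) * x j) - c * c / a 0 0"
      using a0 by (simp add: y(1) field_simps)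
    also have "c * c / a 0 0 = (\<Sum>i<k. \<Sum>j<k. x i * (a 0 (Suc i) * a 0 (Suc j) / a 0 0) * x j)"
      unfolding c_def sum_product sum_divide_distrib by (intro sum.cong) (auto simp: algebra_simps)
    finally show ?thesis
      by (simp add: b_def algebra_simps sum_subtractf)
  qed
  moreover have "b i j = b j i" if "i < k" "j < k" for i j
    using sym that by (simp add: b_def)
  ultimately have "\<exists>r. (\<forall>i j. j < i \<longrightarrow> r i j = 0) \<and> (\<forall>i<k. 0 < r i i) \<and>
      (\<forall>i<k. \<forall>j<k. b i j = (\<Sum>l<k. r l i * r l j))"
    by (intro Suc.IH)
  then obtain r where upper: "\<forall>i j. j < i \<longrightarrow> r i j = 0" and diag: "\<forall>i<k. 0 < r i i"
    and gram: "\<forall>i<k. \<forall>j<k. b i j = (\<Sum>l<k. r l i * r l j)"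
    by (elim exE conjE) (rule that)
  \<comment> \<open>The first row is the first row of \<open>a\<close>, scaled to account for the whole rank-one part that
    was subtracted to form \<open>b\<close>.\<close>
  define s where "s i j = (case i of 0 \<Rightarrow> a 0 j / sqrt (a 0 0)
      | Suc i \<Rightarrow> (case j of 0 \<Rightarrow> 0 | Suc j \<Rightarrow> r i j))" for i j
  have s: "s 0 j = a 0 j / sqrt (a 0 0)" "s (Suc i) 0 = 0" "s (Suc i) (Suc j) = r i j" for i j
    by (auto simp: s_def)
  have "s i j = 0" if "j < i" for i j
    using that upper by (cases i; cases j) (auto simp: s)
  moreover have "0 < s i i" if "i < Suc k" for i
    using that diag a0 by (cases i) (auto simp: s)
  moreover have "a i j = (\<Sum>l<Suc k. s l i * s l j)" if "i < Suc k" "j < Suc k" for i j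
  proof -
    have "(\<Sum>l<Suc k. s l i * s l j) = a 0 i * a 0 j / a 0 0 + (\<Sum>l<k. s (Suc l) i * s (Suc l) j)"
      using a0 by (simp add: sum.lessThan_Suc_shift s del: sum.lessThan_Suc)
    also have "\<dots> = a i j"
    proof (cases i; cases j)
      fix i' j' assume [simp]: "i = Suc i'" "j = Suc j'"
      have "b i' j' = (\<Sum>l<k. r l i' * r l j')" using gram that by simp
      then show ?thesis by (simp add: s b_def)
    qed (use a0 sym that in \<open>auto simp: s\<close>)
    finally show ?thesis ..
  qed
  ultimately show ?case by (intro exI[of _ s]) auto
qed

lemma cholesky_exists:
  assumes "A \<in> spd_mats k"
  shows "\<exists>R. is_cholesky_factor A R"
proof -
  have A: "A \<in> carrier_mat k k" and sym: "A\<^sup>T = A"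
    and pos: "\<And>x. x \<in> carrier_vec k \<Longrightarrow> x \<noteq> 0\<^sub>v k \<Longrightarrow> 0 < x \<bullet> (A *\<^sub>v x)"
    using assms by (auto simp: spd_mats_def)
  have "A $$ (i, j) = A $$ (j, i)" if "i < k" "j < k" for i j
    using arg_cong[OF sym, of "\<lambda>M. M $$ (i, j)"] that A by simp
  moreover have "0 < (\<Sum>i<k. \<Sum>j<k. x i * A $$ (i, j) * x j)" if x: "\<exists>i<k. x i \<noteq> 0" for x
  proof -
    have "vec k x \<noteq> 0\<^sub>v k"
      using x by (metis index_vec index_zero_vec(1))
    then have "0 < vec k x \<bullet> (A *\<^sub>v vec k x)" by (intro pos) auto
    then show ?thesis
      using A by (simp add: scalar_prod_def sum_distrib_left mult.assoc lessThan_atLeast0)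
  qed
  ultimately have "\<exists>r. (\<forall>i j. j < i \<longrightarrow> r i j = 0) \<and> (\<forall>i<k. 0 < r i i) \<and>
      (\<forall>i<k. \<forall>j<k. A $$ (i, j) = (\<Sum>l<k. r l i * r l j))"
    by (rule cholesky_exists_fun)
  then obtain r where upper: "\<forall>i j. j < i \<longrightarrow> r i j = 0" and diag: "\<forall>i<k. 0 < r i i"
    and gram: "\<forall>i<k. \<forall>j<k. A $$ (i, j) = (\<Sum>l<k. r l i * r l j)"
    by (elim exE conjE) (rule that)
  define R where "R = mat k k (\<lambda>(i, j). r i j)"
  have R: "R \<in> carrier_mat k k" by (simp add: R_def)
  have tri: "upper_triangular R" using upper by (simp add: R_def upper_triangular_def)
  have "A = R\<^sup>T * R"
    using A gram by (intro eq_matI) (auto simp: R_def scalar_prod_def lessThan_atLeast0)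
  moreover have "R \<in> GL k"
  proof -
    have "det R = prod_list (diag_mat R)" by (rule det_upper_triangular[OF tri R])
    also have "\<dots> \<noteq> 0"
      using diag by (force simp: diag_mat_def R_def prod_list_zero_iff)
    finally have "det R \<noteq> 0" .
    then obtain B where "B \<in> carrier_mat k k" "B * R = 1\<^sub>m k" "R * B = 1\<^sub>m k"
      using det_non_zero_imp_unit[OF R, of "()"] by (auto simp: Units_def ring_mat_def)
    then show ?thesis
      using R by (auto simp: GL_def invertible_mat_def inverts_mat_def)
  qed
  ultimately have "is_cholesky_factor A R"
    using A tri diag by (simp add: is_cholesky_factor_def R_def)
  then show ?thesis by blast
qed

text \<open>
  For an upper triangular \<open>R\<close>, the \<open>(i, j)\<close> entry of \<open>R\<^sup>T R\<close> is \<open>R\<^sub>i\<^sub>i R\<^sub>i\<^sub>j\<close> plus a term that only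
  involves rows above the \<open>i\<close>-th. Knowing those rows, the entry with \<open>j = i\<close> gives \<open>R\<^sub>i\<^sub>i\<close> up to
  sign, and the sign is positive; the other entries then give the rest of row \<open>i\<close>.
\<close>
lemma upper_triangular_gram_cancel:
  fixes R S :: "real mat"
  assumes R: "R \<in> carrier_mat k k" and S: "S \<in> carrier_mat k k"
    and tri: "upper_triangular R" "upper_triangular S"
    and diag: "\<And>i. i < k \<Longrightarrow> 0 < R $$ (i, i)" "\<And>i. i < k \<Longrightarrow> 0 < S $$ (i, i)"
    and gram: "R\<^sup>T * R = S\<^sup>T * S"
  shows "R = S"
proof -
  have entry: "(T\<^sup>T * T) $$ (i, j) = (\<Sum>l<i. T $$ (l, i) * T $$ (l, j)) + T $$ (i, i) * T $$ (i, j)"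
    if T: "T \<in> carrier_mat k k" "upper_triangular T" and ij: "i < k" "j < k" for i j and T :: "real mat"
  proof -
    have "(T\<^sup>T * T) $$ (i, j) = (\<Sum>l<k. T $$ (l, i) * T $$ (l, j))"
      using T ij by (simp add: scalar_prod_def lessThan_atLeast0)
    also have "\<dots> = (\<Sum>l<Suc i. T $$ (l, i) * T $$ (l, j))"
      using T ij by (intro sum.mono_neutral_right) auto
    finally show ?thesis by simp
  qed
  have rows: "\<forall>j<k. R $$ (i, j) = S $$ (i, j)" if "i < k" for i
    using that
  proof (induction i rule: less_induct)
    case (less i)
    have step: "R $$ (i, i) * R $$ (i, j) = S $$ (i, i) * S $$ (i, j)" if "j < k" for j
    proof -
      have "(\<Sum>l<i. R $$ (l, i) * R $$ (l, j)) = (\<Sum>l<i. S $$ (l, i) * S $$ (l, j))"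
        using less that by (intro sum.cong) auto
      then show ?thesis
        using entry[OF R tri(1) less.prems that] entry[OF S tri(2) less.prems that] gram by simp
    qed
    have "R $$ (i, i) = S $$ (i, i)"
      using step[OF less.prems] diag less.prems by (simp add: square_eq_iff) (metis less_asym neg_0_less_iff_less)
    then show ?case using step diag(1)[OF less.prems] by auto
  qed
  show ?thesis using R S rows by (intro eq_matI) auto
qed

lemma ex1_cholesky_factor:
  assumes "A \<in> spd_mats k"
  shows "\<exists>!R. is_cholesky_factor A R"
proof -
  have A: "A \<in> carrier_mat k k" using assms by (simp add: spd_mats_def)
  obtain R where "is_cholesky_factor A R" using cholesky_exists[OF assms] by blast
  moreover have "R = S" if RS: "is_cholesky_factor A R" "is_cholesky_factor A S" for R S
  proof (rule upper_triangular_gram_cancel)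
    show "R \<in> carrier_mat k k" "S \<in> carrier_mat k k" "upper_triangular R" "upper_triangular S"
      "\<And>i. i < k \<Longrightarrow> 0 < R $$ (i, i)" "\<And>i. i < k \<Longrightarrow> 0 < S $$ (i, i)"
      using RS unfolding is_cholesky_factor_def GL_def carrier_matD(1)[OF A] by blast+
    show "R\<^sup>T * R = S\<^sup>T * S"
      using RS unfolding is_cholesky_factor_def by metis
  qed
  ultimately show ?thesis by blast
qed

section \<open>The fibre of the Gram map over a positive definite matrix\<close>

theorem corollary6p2:
  fixes k n :: nat and A :: "real mat"
  assumes "0 < k" and "0 < n" and "k \<le> n"
    and "A \<in> spd_mats k"
  shows "(\<exists>!R. is_cholesky_factor A R) \<and>
    V_mats A k n = {Q * (cholesky_factor A @\<^sub>r 0\<^sub>m (n - k) k) | Q. Q \<in> O_mats n}"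
proof
  show ex1: "\<exists>!R. is_cholesky_factor A R" by (rule ex1_cholesky_factor) fact
  define R where "R = cholesky_factor A"
  define Z where "Z = R @\<^sub>r 0\<^sub>m (n - k) k"
  have "is_cholesky_factor A R"
    unfolding R_def cholesky_factor_def using ex1 by (rule theI')
  then have R: "R \<in> carrier_mat k k" "A = R\<^sup>T * R"
    using assms(4) by (auto simp: is_cholesky_factor_def GL_def spd_mats_def)
  have Z: "Z \<in> carrier_mat n k"
    using carrier_append_rows[OF R(1) zero_carrier_mat[of "n - k" k]] assms(3) by (simp add: Z_def)
  have gram: "Z\<^sup>T * Z = A"
    using gram_append_zero_rows[OF R(1)] R(2) by (simp add: Z_def)
  have "V_mats A k n = {Q * Z | Q. Q \<in> O_mats n}"
  proof (intro equalityI subsetI)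
    fix Y assume "Y \<in> V_mats A k n"
    then show "Y \<in> {Q * Z | Q. Q \<in> O_mats n}"
      using gram_eq_iff_orthogonally_equivalent[OF _ Z, of Y] gram by (auto simp: V_mats_def)
  next
    fix Y assume "Y \<in> {Q * Z | Q. Q \<in> O_mats n}"
    then obtain Q where Q: "Q \<in> O_mats n" "Y = Q * Z" by auto
    then have "Y \<in> carrier_mat n k" using Z by (auto simp: O_mats_def)
    then show "Y \<in> V_mats A k n"
      using gram_eq_iff_orthogonally_equivalent[OF _ Z, of Y] gram Q by (auto simp: V_mats_def)
  qed
  then show "V_mats A k n = {Q * (cholesky_factor A @\<^sub>r 0\<^sub>m (n - k) k) | Q. Q \<in> O_mats n}"
    by (simp add: Z_def R_def)
qed

end
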